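(* Let $\mathscr{A} \in \mathbb{E}$ be such that, for some integer $r \ge 3$, real numbers $\alpha_1,\dots,\alpha_r$ and real $3\times 3$ matrices $\mathbf{U}_1,\dots,\mathbf{U}_r$, $$\mathscr{A}\mathbf{y}^2 = \sum_{s=1}^r \alpha_s (\mathbf{U}_s\mathbf{y})(\mathbf{U}_s\mathbf{y})^\top \quad \text{for all } \mathbf{y} \in \mathbb{R}^3,$$ where (i) $\alpha_1,\alpha_2,\alpha_3 > 0$ and $\alpha_4,\dots,\alpha_r < 0$; (ii) $\mathbf{U}_s = \mathbf{v}_s\mathbf{w}_s^\top$ with $\mathbf{v}_s,\mathbf{w}_s \in \mathbb{R}^3$ for $s = 1,2,3$; (iii) the matrices $\mathbf{V} = [\mathbf{v}_1,\mathbf{v}_2,\mathbf{v}_3]$ and $\mathbf{W} = [\mathbf{w}_1,\mathbf{w}_2,\mathbf{w}_3]$ are nonsingular. Then $\mathscr{A}$ is M-PSD if and only if there exist real numbers $\sigma_{s1},\sigma_{s2},\sigma_{s3}$ ($s = 4,\dots,r$) such that (i) $\mathbf{U}_s = \mathbf{V}\boldsymbol{\Sigma}_s\mathbf{W}^\top$ with $\boldsymbol{\Sigma}_s = \mathrm{diag}(\sigma_{s1},\sigma_{s2},\sigma_{s3})$ for $s = 4,\dots,r$; and (ii) the matrix $\mathrm{diag}(\alpha_1,\alpha_2,\alpha_3) + \sum_{s=4}^r \alpha_s\boldsymbol{\sigma}_s\boldsymbol{\sigma}_s^\top$ is positive semidefinite, where $\boldsymbol{\sigma}_s = [\sigma_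{s1},\sigma_{s2},\sigma_{s3}]^\top$.
   Context: $\mathbb{E}$ denotes the set of all real fourth-order three-dimensional tensors $\mathscr{A} = (a_{ijkl}) \in \mathbb{R}^{3\times 3\times 3\times 3}$ such that $a_{ijkl} = a_{jikl} = a_{ijlk}$ for all $i,j,k,l \in \{1,2,3\}$. For $\mathbf{y} \in \mathbb{R}^3$, $\mathscr{A}\mathbf{y}^2$ is the symmetric $3\times 3$ matrix with entries $(\mathscr{A}\mathbf{y}^2)_{ij} := \sum_{k,l=1}^3 a_{ijkl}y_ky_l$. The tensor $\mathscr{A}$ is M-positive semidefinite (M-PSD) if $\mathscr{A}\mathbf{x}^2\mathbf{y}^2 := \sum_{i,j,k,l=1}^3 a_{ijkl}x_ix_jy_ky_l \geq 0$ for all $\mathbf{x},\mathbf{y} \in \mathbb{R}^3$. When $r=3$ the conditions on indices $s \ge 4$ are vacuous and the corresponding sums are empty. *)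

theory Defs
  imports "HOL-Analysis.Analysis"
begin

type_synonym tensor4 = "real ^ 3 ^ 3 ^ 3 ^ 3"

definition tensor_space_E :: "tensor4 set" where
  "tensor_space_E = {A. \<forall>i j k l. A $ i $ j $ k $ l = A $ j $ i $ k $ l
                                  \<and> A $ i $ j $ k $ l = A $ i $ j $ l $ k}"

definition tensor_y2 :: "tensor4 \<Rightarrow> real ^ 3 \<Rightarrow> real ^ 3 ^ 3" where
  "tensor_y2 A y = (\<chi> i j. \<Sum>k\<in>UNIV. \<Sum>l\<in>UNIV. A $ i $ j $ k $ l * y $ k * y $ l)"

definition tensor_x2y2 :: "tensor4 \<Rightarrow> real ^ 3 \<Rightarrow> real ^ 3 \<Rightarrow> real" where
  "tensor_x2y2 A x y =
     (\<Sum>i\<in>UNIV. \<Sum>j\<in>UNIV. \<Sum>k\<in>UNIV. \<Sum>l\<in>UNIV.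
        A $ i $ j $ k $ l * x $ i * x $ j * y $ k * y $ l)"

definition M_PSD :: "tensor4 \<Rightarrow> bool" where
  "M_PSD A \<longleftrightarrow> (\<forall>x y. tensor_x2y2 A x y \<ge> 0)"

definition outer :: "real ^ 'm \<Rightarrow> real ^ 'n \<Rightarrow> real ^ 'n ^ 'm" where
  "outer x y = (\<chi> i j. x $ i * y $ j)"

definition diag_mat :: "real ^ 'n \<Rightarrow> real ^ 'n ^ 'n" where
  "diag_mat d = (\<chi> i j. if i = j then d $ i else 0)"

text \<open>A list given to \<^const>\<open>vector\<close> lists rows; transposing makes \<open>a\<close>, \<open>b\<close>, \<open>c\<close> the columns.\<close>

definition cols3 :: "real ^ 3 \<Rightarrow> real ^ 3 \<Rightarrow> real ^ 3 \<Rightarrow> real ^ 3 ^ 3" where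
  "cols3 a b c = transpose (vector [a, b, c])"

definition psd_mat :: "real ^ 'n ^ 'n \<Rightarrow> bool" where
  "psd_mat M \<longleftrightarrow> transpose M = M \<and> (\<forall>x. x \<bullet> (M *v x) \<ge> 0)"

end

theory Submission
  imports Defs
begin

text \<open>Writing \<open>B\<^sub>s = V\<^sup>-\<^sup>1 U\<^sub>s W\<^sup>-\<^sup>T\<close>, \<open>p = V\<^sup>T x\<close> and \<open>q = W\<^sup>T y\<close>, the biquadratic
  form becomes \<open>\<Sum>\<^sub>i \<alpha>\<^sub>i p\<^sub>i\<^sup>2 q\<^sub>i\<^sup>2 + \<Sum>\<^sub>s \<alpha>\<^sub>s (p \<bullet> B\<^sub>s q)\<^sup>2\<close>, the second sum having only
  negative coefficients, and \<open>p\<close>, \<open>q\<close> range over all vectors. At distinct unit vectors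
  \<open>p = e\<^sub>i\<close>, \<open>q = e\<^sub>j\<close> the first sum vanishes, so nonnegativity kills the off-diagonal entries of
  every \<open>B\<^sub>s\<close>. Once the \<open>B\<^sub>s\<close> are diagonal, the form depends only on the componentwise product
  of \<open>p\<close> and \<open>q\<close>, an arbitrary vector, and is the quadratic form of the matrix in question.\<close>

lemma outer_mult_vec: "outer a b *v x = (b \<bullet> x) *\<^sub>R a"
  by (simp add: vec_eq_iff outer_def matrix_vector_mult_def inner_vec_def sum_distrib_left
      mult_ac)

lemma inner_diag_mat: "x \<bullet> (diag_mat d *v y) = (\<Sum>i\<in>UNIV. d $ i * (x $ i * y $ i))"
proof -
  have "(diag_mat d *v y) $ i = d $ i * y $ i" for i
    by (simp add: diag_mat_def matrix_vector_mult_def if_distrib [of "\<lambda>t. t * _"] cong: if_cong)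
  then show ?thesis
    by (simp add: inner_vec_def mult_ac)
qed

lemma scaleR_matrix_vector_mult: "(c *\<^sub>R M) *v x = c *\<^sub>R (M *v (x :: real ^ 'n))"
  by (simp add: vec_eq_iff matrix_vector_mult_def sum_distrib_left mult_ac)

lemma sum_matrix_vector_mult:
  "(\<Sum>s\<in>S. M s) *v (x :: real ^ 'n) = (\<Sum>s\<in>S. M s *v x)"
  by (induction S rule: infinite_finite_induct) (simp_all add: matrix_vector_mult_add_rdistrib)

text \<open>Serves twice: with \<open>a s = U s *v y\<close> it expands the biquadratic form, and
  with \<open>a s = \<sigma> s\<close> the quadratic form of the candidate matrix, so both become
  weighted sums of squares.\<close>

lemma quadratic_form_sum_outer:
  "x \<bullet> ((\<Sum>s\<in>S. c s *\<^sub>R outer (a s) (a s)) *v x) = (\<Sum>s\<in>S. c s * (x \<bullet> a s)\<^sup>2)"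
  by (simp add: sum_matrix_vector_mult scaleR_matrix_vector_mult outer_mult_vec inner_sum_right
      inner_commute power2_eq_square mult_ac)

lemma tensor_x2y2_eq_inner: "tensor_x2y2 A x y = x \<bullet> (tensor_y2 A y *v x)"
  by (simp add: tensor_x2y2_def tensor_y2_def inner_vec_def matrix_vector_mult_def
      sum_distrib_left sum_distrib_right mult_ac)

lemma transpose_diag_plus_sum_outer:
  "transpose (diag_mat d + (\<Sum>s\<in>S. c s *\<^sub>R outer (a s) (a s))) =
    diag_mat d + (\<Sum>s\<in>S. c s *\<^sub>R outer (a s) (a s))"
  by (simp add: vec_eq_iff transpose_def diag_mat_def outer_def mult_ac)

lemma transpose_cols3_mult_vec:
  "transpose (cols3 a b c) *v x = vector [a \<bullet> x, b \<bullet> x, c \<bullet> x]"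
  by (simp add: vec_eq_iff forall_3 cols3_def matrix_vector_mult_def inner_vec_def)

lemma inner_axis_matrix: "axis i 1 \<bullet> (M *v axis j 1) = (M $ i $ j :: real)"
  by (simp add: inner_axis' matrix_vector_mul_component inner_axis)

lemma surj_transpose_mult_vec:
  fixes V :: "real ^ 'n ^ 'n"
  assumes "invertible V"
  obtains x where "transpose V *v x = p"
proof -
  have "invertible (transpose V)"
    using assms by (simp add: transpose_invertible)
  then obtain V' where "transpose V ** V' = mat 1"
    unfolding invertible_def by blast
  then have "transpose V *v (V' *v p) = p"
    by (simp add: matrix_vector_mul_assoc)
  then show thesis
    by (rule that)
qed

text \<open>Take \<open>B\<close> to be V^-1 U W^-T; this is the coordinate matrix that stands in
  for each \<open>U s\<close>.\<close>

lemma invertible_sandwich: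
  fixes V W U :: "real ^ 'n ^ 'n"
  assumes "invertible V" "invertible W"
  obtains B where "U = V ** B ** transpose W"
proof -
  obtain V' where V': "V ** V' = mat 1"
    using assms unfolding invertible_def by blast
  have "invertible (transpose W)"
    using assms by (simp add: transpose_invertible)
  then obtain W' where W': "W' ** transpose W = mat 1"
    unfolding invertible_def by blast
  have "V ** (V' ** U ** W') ** transpose W = V ** V' ** U ** (W' ** transpose W)"
    by (simp only: matrix_mul_assoc)
  also have "\<dots> = U"
    by (simp only: V' W' matrix_mul_lid matrix_mul_rid)
  finally show thesis
    using that by metis
qed

text \<open>Cancelling V on the left and W^T on the right recovers the middle factor. Uniqueness of
  the coordinate matrix is what turns "\<open>B s\<close> is diagonal" into the stated factorization
  of \<open>U s\<close>.\<close>

lemma sandwich_inject: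
  fixes V W B C :: "real ^ 'n ^ 'n"
  assumes "invertible V" "invertible W" "V ** B ** transpose W = V ** C ** transpose W"
  shows "B = C"
proof -
  obtain V' where V': "V' ** V = mat 1"
    using assms(1) unfolding invertible_def by blast
  have "invertible (transpose W)"
    using assms(2) by (simp add: transpose_invertible)
  then obtain W' where W': "transpose W ** W' = mat 1"
    unfolding invertible_def by blast
  have "X = V' ** (V ** X ** transpose W) ** W'" for X
  proof -
    have "V' ** (V ** X ** transpose W) ** W' = V' ** V ** X ** (transpose W ** W')"
      by (simp only: matrix_mul_assoc)
    then show ?thesis
      by (simp only: V' W' matrix_mul_lid matrix_mul_rid)
  qed
  then show ?thesis
    using assms(3) by metis
qed

text \<open>V moves across the inner product as its adjoint, so V and W survive only inside p = V^T
  x and q = W^T y.\<close>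

lemma inner_sandwich:
  fixes V W B :: "real ^ 'n ^ 'n"
  shows "x \<bullet> ((V ** B ** transpose W) *v y) = (transpose V *v x) \<bullet> (B *v (transpose W *v y))"
  by (simp add: dot_lmul_matrix matrix_vector_mul_assoc [symmetric])

lemma biquadratic_diagonal_iff:
  fixes d :: "real ^ 'n" and c :: "'s \<Rightarrow> real" and B :: "'s \<Rightarrow> real ^ 'n ^ 'n"
  assumes "finite S" and neg: "\<And>s. s \<in> S \<Longrightarrow> c s < 0"
  defines "h \<equiv> \<lambda>p q. (\<Sum>i\<in>UNIV. d $ i * (p $ i * q $ i)\<^sup>2) + (\<Sum>s\<in>S. c s * (p \<bullet> (B s *v q))\<^sup>2)"
  shows "(\<forall>p q. 0 \<le> h p q) \<longleftrightarrow>
    (\<exists>\<sigma>. (\<forall>s\<in>S. B s = diag_mat (\<sigma> s)) \<and>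
      psd_mat (diag_mat d + (\<Sum>s\<in>S. c s *\<^sub>R outer (\<sigma> s) (\<sigma> s))))"
    (is "?L \<longleftrightarrow> ?R")
proof -
  define N where "N \<sigma> = diag_mat d + (\<Sum>s\<in>S. c s *\<^sub>R outer (\<sigma> s) (\<sigma> s))" for \<sigma> :: "'s \<Rightarrow> real ^ 'n"
  have h_diag: "h p q = z \<bullet> (N \<sigma> *v z)"
    if "\<forall>s\<in>S. B s = diag_mat (\<sigma> s)" "z = (\<chi> i. p $ i * q $ i)" for p q z \<sigma>
  proof -
    have "p \<bullet> (B s *v q) = z \<bullet> \<sigma> s" if "s \<in> S" for s
      using that \<open>\<forall>s\<in>S. _\<close> \<open>z = _\<close>
      by (simp add: inner_diag_mat) (simp add: inner_vec_def mult_ac)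
    then show ?thesis
      unfolding h_def N_def matrix_vector_mult_add_rdistrib inner_add_right quadratic_form_sum_outer
      using \<open>z = _\<close> by (simp add: inner_diag_mat power2_eq_square)
  qed
  have "?R" if "?L"
  proof -
    have off: "B s $ i $ j = 0" if "s \<in> S" "i \<noteq> j" for s i j
    proof -
      \<comment> \<open>Since i and j differ, no coordinate k is nonzero in both axis
        vectors.\<close>
      have "d $ k * ((axis i 1 :: real ^ 'n) $ k * (axis j 1 :: real ^ 'n) $ k)\<^sup>2 = 0" for k
        using \<open>i \<noteq> j\<close> by (simp add: axis_def)
      then have "h (axis i 1) (axis j 1) = (\<Sum>s\<in>S. c s * (B s $ i $ j)\<^sup>2)"
        by (simp only: h_def inner_axis_matrix sum.neutral_const add_0_left)
      then have "0 \<le> (\<Sum>s\<in>S. c s * (B s $ i $ j)\<^sup>2)"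
        using \<open>?L\<close> by metis
      \<comment> \<open>Every summand is nonpositive while the sum is nonnegative, so each one
        vanishes; signs are flipped to argue with nonnegative terms.\<close>
      moreover have nonneg: "0 \<le> - (c s * (B s $ i $ j)\<^sup>2)" if "s \<in> S" for s
        using neg [OF that] by (simp add: mult_le_0_iff)
      then have "0 \<le> (\<Sum>s\<in>S. - (c s * (B s $ i $ j)\<^sup>2))"
        by (rule sum_nonneg)
      ultimately have "(\<Sum>s\<in>S. - (c s * (B s $ i $ j)\<^sup>2)) = 0"
        by (simp add: sum_negf)
      then have "c s * (B s $ i $ j)\<^sup>2 = 0"
        using sum_nonneg_eq_0_iff [OF \<open>finite S\<close> nonneg] \<open>s \<in> S\<close> by simp
      then show ?thesis
        using neg [OF \<open>s \<in> S\<close>] by simp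
    qed
    define \<sigma> where "\<sigma> s = (\<chi> i. B s $ i $ i)" for s
    have B: "\<forall>s\<in>S. B s = diag_mat (\<sigma> s)"
      by (auto simp: vec_eq_iff diag_mat_def \<sigma>_def off)
    have "0 \<le> z \<bullet> (N \<sigma> *v z)" for z
    proof -
      \<comment> \<open>With the all-ones vector as q, the componentwise product is z itself, so
        every z is reached.\<close>
      have "0 \<le> h z (\<chi> i. 1)"
        using \<open>?L\<close> by blast
      also have "\<dots> = z \<bullet> (N \<sigma> *v z)"
        by (rule h_diag [OF B]) simp
      finally show ?thesis .
    qed
    then have "psd_mat (N \<sigma>)"
      by (simp add: psd_mat_def N_def transpose_diag_plus_sum_outer)
    with B show ?thesis
      unfolding N_def by blast
  qed
  moreover have "?L" if "?R"
  proof (intro allI)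
    fix p q
    obtain \<sigma> where B: "\<forall>s\<in>S. B s = diag_mat (\<sigma> s)" and "psd_mat (N \<sigma>)"
      using \<open>?R\<close> unfolding N_def by blast
    then have "0 \<le> (\<chi> i. p $ i * q $ i) \<bullet> (N \<sigma> *v (\<chi> i. p $ i * q $ i))"
      unfolding psd_mat_def by blast
    then show "0 \<le> h p q"
      by (simp only: h_diag [OF B refl])
  qed
  ultimately show ?thesis
    by blast
qed

theorem theorem4p1:
  fixes A :: tensor4 and r :: nat and \<alpha> :: "nat \<Rightarrow> real"
    and U :: "nat \<Rightarrow> real ^ 3 ^ 3" and v w :: "nat \<Rightarrow> real ^ 3"
    and V W :: "real ^ 3 ^ 3"
  assumes "A \<in> tensor_space_E"
    and "r \<ge> 3"
    and "\<And>y. tensor_y2 A y = (\<Sum>s = 1..r. \<alpha> s *\<^sub>R outer (U s *v y) (U s *v y))"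
    and "\<And>s. s \<in> {1..3} \<Longrightarrow> \<alpha> s > 0"
    and "\<And>s. s \<in> {4..r} \<Longrightarrow> \<alpha> s < 0"
    and "\<And>s. s \<in> {1..3} \<Longrightarrow> U s = outer (v s) (w s)"
    and "V = cols3 (v 1) (v 2) (v 3)"
    and "W = cols3 (w 1) (w 2) (w 3)"
    and "invertible V" and "invertible W"
  shows "M_PSD A \<longleftrightarrow>
    (\<exists>\<sigma> :: nat \<Rightarrow> real ^ 3.
       (\<forall>s\<in>{4..r}. U s = V ** diag_mat (\<sigma> s) ** transpose W) \<and>
       psd_mat (diag_mat (vector [\<alpha> 1, \<alpha> 2, \<alpha> 3])
                + (\<Sum>s = 4..r. \<alpha> s *\<^sub>R outer (\<sigma> s) (\<sigma> s))))"
proof -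
  define d :: "real ^ 3" where "d = vector [\<alpha> 1, \<alpha> 2, \<alpha> 3]"
  have "\<exists>B. U s = V ** B ** transpose W" for s
    using invertible_sandwich [OF assms(9,10)] by metis
  then obtain B where B: "\<And>s. U s = V ** B s ** transpose W"
    by metis
  have B_eq_iff: "B s = D \<longleftrightarrow> U s = V ** D ** transpose W" for s D
    using sandwich_inject [OF assms(9,10)] B by metis
  have form: "tensor_x2y2 A x y =
      (\<Sum>i\<in>UNIV. d $ i * ((transpose V *v x) $ i * (transpose W *v y) $ i)\<^sup>2) +
      (\<Sum>s = 4..r. \<alpha> s * ((transpose V *v x) \<bullet> (B s *v (transpose W *v y)))\<^sup>2)" for x y
  proof -
    have "tensor_x2y2 A x y = (\<Sum>s = 1..r. \<alpha> s * (x \<bullet> (U s *v y))\<^sup>2)"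
      by (simp only: tensor_x2y2_eq_inner assms(3) quadratic_form_sum_outer)
    \<comment> \<open>The positive and negative coefficients are separated; for r = 3 the second
      block is empty.\<close>
    also have "{1..r} = {1..3} \<union> {4..r}"
      using \<open>r \<ge> 3\<close> by auto
    also have "(\<Sum>s\<in>\<dots>. \<alpha> s * (x \<bullet> (U s *v y))\<^sup>2) =
        (\<Sum>s = 1..3. \<alpha> s * (x \<bullet> (U s *v y))\<^sup>2) + (\<Sum>s = 4..r. \<alpha> s * (x \<bullet> (U s *v y))\<^sup>2)"
      by (rule sum.union_disjoint) auto
    \<comment> \<open>A rank-one \<open>U s\<close> makes the bilinear form split into a product of
      two linear forms, which are the coordinates of p and q.\<close>
    also have "(\<Sum>s = 1..3. \<alpha> s * (x \<bullet> (U s *v y))\<^sup>2) =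
        (\<Sum>s = 1..3. \<alpha> s * ((v s \<bullet> x) * (w s \<bullet> y))\<^sup>2)"
      by (rule sum.cong) (simp_all add: assms(6) outer_mult_vec inner_commute mult.commute)
    also have "\<dots> = (\<Sum>i\<in>UNIV. d $ i * ((transpose V *v x) $ i * (transpose W *v y) $ i)\<^sup>2)"
      by (simp add: sum_3 d_def assms(7,8) transpose_cols3_mult_vec eval_nat_numeral
          del: transpose_matrix_vector)
    finally show ?thesis
      by (simp only: B inner_sandwich)
  qed
  have "M_PSD A \<longleftrightarrow> (\<forall>p q. 0 \<le> (\<Sum>i\<in>UNIV. d $ i * (p $ i * q $ i)\<^sup>2) +
      (\<Sum>s = 4..r. \<alpha> s * (p \<bullet> (B s *v q))\<^sup>2))"
    (is "_ \<longleftrightarrow> (\<forall>p q. 0 \<le> ?h p q)")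
  proof
    assume "M_PSD A"
    show "\<forall>p q. 0 \<le> ?h p q"
    proof (intro allI)
      fix p q
      \<comment> \<open>Nonsingularity of V and W makes every pair (p, q) come from some pair (x,
        y).\<close>
      obtain x where x: "transpose V *v x = p"
        using surj_transpose_mult_vec [OF assms(9)] .
      obtain y where y: "transpose W *v y = q"
        using surj_transpose_mult_vec [OF assms(10)] .
      have "0 \<le> tensor_x2y2 A x y"
        using \<open>M_PSD A\<close> by (simp add: M_PSD_def)
      then show "0 \<le> ?h p q"
        by (simp only: form x y)
    qed
  qed (simp add: M_PSD_def form)
  also have "\<dots> \<longleftrightarrow> (\<exists>\<sigma>. (\<forall>s\<in>{4..r}. B s = diag_mat (\<sigma> s)) \<and>
      psd_mat (diag_mat d + (\<Sum>s = 4..r. \<alpha> s *\<^sub>R outer (\<sigma> s) (\<sigma> s))))"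
    by (rule biquadratic_diagonal_iff) (use assms(5) in auto)
  finally show ?thesis
    unfolding d_def B_eq_iff .
qed

end
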